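(* Let $X$ be a bounded metric space and let $E,F$ be Banach spaces. Let $\Xi:X\times E\to F$ be a function such that for every $f\in\operatorname{Lip}(X,E)$ the function $x\mapsto\Xi(x,f(x))$ belongs to $\operatorname{Lip}(X,F)$. Let $x_0$ be an accumulation point of $X$. Then there is a dense open set $O$ in $E$ such that $\Xi(x_0,\cdot)$ is continuous on $O$.
   Context: $\operatorname{Lip}(X,E)$ is the space of all Lipschitz functions $X\to E$. *)

theory Defs
  imports "HOL-Analysis.Analysis"
begin

(* Lip(X,E), with E a whole type: functions are total in HOL, so values outside X are arbitrary
   and irrelevant for membership. *)
definition Lip :: "'a::metric_space set \<Rightarrow> ('a \<Rightarrow> 'e::real_normed_vector) set" where
  "Lip X = {f. \<exists>C. C-lipschitz_on X f}"

end

theory Submission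
  imports Defs
begin

text \<open>
  Write \<open>\<phi> = \<Xi>(x\<^sub>0, \<cdot>)\<close>. Each constant function \<open>e\<close> is Lipschitz, so \<open>x \<mapsto> \<Xi>(x, e)\<close> is Lipschitz on \<open>X\<close>;
  let \<open>A\<^sub>n\<close> be the set of those \<open>e\<close> for which \<open>n\<close> is a Lipschitz constant. The sets \<open>A\<^sub>n\<close>
  cover \<open>E\<close>, so Baire's theorem makes the union of the interiors of their closures
  dense (\<open>dense_Union_interior_closure\<close>), and it suffices that \<open>\<phi>\<close> is continuous on the closure
  of each \<open>A\<^sub>n\<close>. For that it is enough that \<open>\<phi>(y) \<rightarrow> \<phi>(e)\<close> as \<open>y \<rightarrow> e\<close> inside \<open>A\<^sub>n\<close>,
  for every \<open>e\<close>.

  Suppose this fails, so that there are \<open>y \<in> A\<^sub>n\<close> arbitrarily close to \<open>e\<close> with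
  \<open>\<phi>(y)\<close> at distance at least \<open>\<epsilon>\<close> from \<open>\<phi>(e)\<close>. Take points \<open>p\<^sub>k \<in> X\<close> approaching
  \<open>x\<^sub>0\<close> geometrically fast, and then such points \<open>y\<^sub>k\<close> with \<open>\<parallel>y\<^sub>k - e\<parallel> \<le> d(p\<^sub>k, x\<^sub>0)\<close>.
  Some Lipschitz \<open>f\<close> has \<open>f(p\<^sub>k) = y\<^sub>k\<close> and \<open>f(x\<^sub>0) = e\<close>
  (\<open>lipschitz_interpolation_lacunary\<close>). If \<open>C\<close> is a Lipschitz constant of
  \<open>x \<mapsto> \<Xi>(x, f(x))\<close>, then
  \<open>\<parallel>\<phi>(y\<^sub>k) - \<phi>(e)\<parallel> \<le> \<parallel>\<Xi>(x\<^sub>0, y\<^sub>k) - \<Xi>(p\<^sub>k, y\<^sub>k)\<parallel> + \<parallel>\<Xi>(p\<^sub>k, f(p\<^sub>k)) - \<Xi>(x\<^sub>0, f(x\<^sub>0))\<parallel>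
  \<le> (n + C) d(p\<^sub>k, x\<^sub>0)\<close>, which tends to \<open>0\<close>: a contradiction.
\<close>

text \<open>
  No uniform bound on the number of pieces enters: where one piece is nonzero at
  one of two points and vanishes at the other, its value is bounded by \<open>L\<close> times the
  distance of the points, and at most two pieces are involved.
\<close>
lemma lipschitz_on_glue_disjoint_supports:
  fixes h :: "'i \<Rightarrow> 'a::metric_space \<Rightarrow> 'e::real_normed_vector"
  assumes lip: "\<And>k. L-lipschitz_on S (h k)"
    and disj: "\<And>k l x. h k x \<noteq> 0 \<Longrightarrow> h l x \<noteq> 0 \<Longrightarrow> k = l"
  obtains g where "(2 * L)-lipschitz_on S g" "\<And>k x. h k x \<noteq> 0 \<Longrightarrow> g x = h k x"
    "\<And>x. (\<And>k. h k x = 0) \<Longrightarrow> g x = 0"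
proof -
  define g where "g = (\<lambda>x. h (SOME k. h k x \<noteq> 0) x)"
  have g_eq: "g x = h k x" if "h k x \<noteq> 0" for k x
    unfolding g_def using that disj by (metis (mono_tags, lifting) someI_ex)
  have L: "0 \<le> L"
    using lip lipschitz_on_nonneg by blast
  have alt: "dist (g x) (g y) \<le> L * dist x y \<or> norm (g x) \<le> L * dist x y"
    if xy: "x \<in> S" "y \<in> S" for x y
  proof -
    obtain k where k: "g x = h k x"
      by (simp add: g_def)
    have "dist (h k x) (h k y) \<le> L * dist x y"
      using lipschitz_onD[OF lip xy] .
    then show ?thesis
      using k g_eq[of k y] by (cases "h k y = 0") auto
  qed
  have "dist (g x) (g y) \<le> 2 * L * dist x y" if "x \<in> S" "y \<in> S" for x y
  proof -
    have "0 \<le> L * dist x y"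
      using L by simp
    moreover have "dist (g x) (g y) \<le> norm (g x) + norm (g y)"
      by (simp add: dist_norm norm_triangle_ineq4)
    ultimately show ?thesis
      using alt[OF that] alt[OF that(2,1)] by (auto simp: dist_commute)
  qed
  then have "(2 * L)-lipschitz_on S g"
    using L by (intro lipschitz_onI) auto
  moreover have "g x = 0" if "\<And>k. h k x = 0" for x
    using that by (simp add: g_def)
  ultimately show thesis
    using that g_eq by blast
qed

text \<open>
  With \<open>r\<^sub>k = d(p\<^sub>k, a)\<close>, the balls of radius \<open>r\<^sub>k / 4\<close> about the \<open>p\<^sub>k\<close> are pairwise disjoint and
  miss \<open>a\<close>. A cone over such a ball with height at most \<open>r\<^sub>k\<close> has slope at most \<open>4\<close>, whatever \<open>k\<close>,
  and the cones can be glued.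
\<close>
lemma lipschitz_interpolation_lacunary:
  fixes p :: "nat \<Rightarrow> 'a::metric_space" and v :: "nat \<Rightarrow> 'e::real_normed_vector"
  assumes pos: "\<And>k. 0 < dist (p k) a"
    and lacunary: "\<And>k. 2 * dist (p (Suc k)) a \<le> dist (p k) a"
    and v: "\<And>k. dist (v k) e \<le> dist (p k) a"
  obtains f where "8-lipschitz_on UNIV f" "f a = e" "\<And>k. f (p k) = v k"
proof -
  define r where "r = (\<lambda>k. dist (p k) a)"
  define h where "h = (\<lambda>k x. max 0 (1 - 4 * dist x (p k) / r k) *\<^sub>R (v k - e))"
  have r_pos: "0 < r k" for k
    using pos by (simp add: r_def)
  have r_half: "2 * r l \<le> r k" if "k < l" for k l
    using that
  proof (induction l)
    case (Suc l)
    have "2 * r (Suc l) \<le> r l"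
      using lacunary by (simp add: r_def)
    then show ?case
      using Suc r_pos[of l] by (cases "k = l") auto
  qed simp
  have lip: "4-lipschitz_on UNIV (h k)" for k
  proof (rule lipschitz_onI)
    fix x y
    let ?b = "\<lambda>x. max 0 (1 - 4 * dist x (p k) / r k)"
    have "\<bar>dist x (p k) - dist y (p k)\<bar> \<le> dist x y"
      by (metis abs_dist_diff_le dist_commute)
    then have "4 * \<bar>dist x (p k) - dist y (p k)\<bar> / r k \<le> 4 * dist x y / r k"
      using r_pos[of k] by (intro divide_right_mono) auto
    moreover have "4 * dist x (p k) / r k - 4 * dist y (p k) / r k
        = 4 * (dist x (p k) - dist y (p k)) / r k"
      by (simp add: right_diff_distrib diff_divide_distrib)
    then have "\<bar>4 * dist x (p k) / r k - 4 * dist y (p k) / r k\<bar>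
        = 4 * \<bar>dist x (p k) - dist y (p k)\<bar> / r k"
      using r_pos[of k] by (simp only: abs_mult abs_divide)
    ultimately have b: "\<bar>?b x - ?b y\<bar> \<le> 4 * dist x y / r k"
      by linarith
    have "dist (h k x) (h k y) = \<bar>?b x - ?b y\<bar> * norm (v k - e)"
      by (simp add: h_def dist_norm flip: scaleR_left_diff_distrib)
    also have "\<dots> \<le> (4 * dist x y / r k) * r k"
      using b v[of k] r_pos[of k]
      by (intro mult_mono) (auto simp: r_def dist_norm)
    finally show "dist (h k x) (h k y) \<le> 4 * dist x y"
      using r_pos[of k] by simp
  qed simp
  have supp: "dist x (p k) < r k / 4" if "h k x \<noteq> 0" for k x
    using that r_pos[of k] by (auto simp: h_def max_def field_simps split: if_splits)
  have not_less: "\<not> k < l" if "dist x (p k) < r k / 4" "dist x (p l) < r l / 4" for k l x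
  proof
    assume "k < l"
    have "r k \<le> dist x (p k) + dist x a"
      unfolding r_def by (rule dist_triangle3)
    moreover have "dist x a \<le> dist x (p l) + r l"
      unfolding r_def by (rule dist_triangle)
    ultimately show False
      using that r_half[OF \<open>k < l\<close>] r_pos[of k] by linarith
  qed
  have disj: "k = l" if "dist x (p k) < r k / 4" "dist x (p l) < r l / 4" for k l x
    using not_less[OF that] not_less[OF that(2,1)] by simp
  then have "k = l" if "h k x \<noteq> 0" "h l x \<noteq> 0" for k l x
    using supp that by blast
  with lip obtain g where g: "(2 * 4)-lipschitz_on UNIV g"
      "\<And>k x. h k x \<noteq> 0 \<Longrightarrow> g x = h k x" "\<And>x. (\<And>k. h k x = 0) \<Longrightarrow> g x = 0"
    using lipschitz_on_glue_disjoint_supports[of 4 UNIV h] by metis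
  have ga: "g a = 0"
  proof (rule g(3))
    show "h k a = 0" for k
      using r_pos[of k] by (simp add: h_def r_def dist_commute)
  qed
  have hp: "h k (p k) = v k - e" for k
    by (simp add: h_def)
  have gp: "g (p k) = v k - e" for k
  proof (cases "v k = e")
    case True
    have "h l (p k) = 0" for l
    proof (rule ccontr)
      assume "h l (p k) \<noteq> 0"
      moreover from this have "l = k"
        using disj[OF supp, of l "p k" k] r_pos[of k] by simp
      ultimately show False
        using hp True by simp
    qed
    then show ?thesis
      using g(3) True by simp
  next
    case False
    then show ?thesis
      using g(2)[of k "p k"] hp by simp
  qed
  show thesis
  proof (rule that[of "\<lambda>x. g x + e"])
    show "8-lipschitz_on UNIV (\<lambda>x. g x + e)"
      using g(1) by (simp add: lipschitz_on_def)
  qed (simp_all add: ga gp)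
qed

lemma lacunary_sequence_to_limit_point:
  fixes a :: "'a::metric_space"
  assumes "a islimpt S"
  obtains p where "\<And>k::nat. p k \<in> S" "\<And>k. 0 < dist (p k) a"
    "\<And>k. 2 * dist (p (Suc k)) a \<le> dist (p k) a" "(\<lambda>k. dist (p k) a) \<longlonglongrightarrow> 0"
proof -
  let ?P = "\<lambda>k x. x \<in> S \<and> 0 < dist x a \<and> dist x a \<le> inverse (real (Suc k))"
  have near: "\<exists>x\<in>S. 0 < dist x a \<and> dist x a < \<epsilon>" if "0 < \<epsilon>" for \<epsilon>
    using assms that unfolding islimpt_approachable by auto
  have "\<exists>p. \<forall>k. ?P k (p k) \<and> 2 * dist (p (Suc k)) a \<le> dist (p k) a"
  proof (rule dependent_nat_choice)
    show "\<exists>x. ?P 0 x"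
      using near[of 1] by force
    fix x k
    assume "?P k x"
    then show "\<exists>y. ?P (Suc k) y \<and> 2 * dist y a \<le> dist x a"
      using near[of "min (inverse (real (Suc (Suc k)))) (dist x a / 2)"] by force
  qed
  then obtain p where p: "\<And>k. ?P k (p k)" "\<And>k. 2 * dist (p (Suc k)) a \<le> dist (p k) a"
    by metis
  have "(\<lambda>k. dist (p k) a) \<longlonglongrightarrow> 0"
    using p(1) by (intro tendsto_sandwich[OF _ _ tendsto_const LIMSEQ_inverse_real_of_nat]) auto
  then show thesis
    using that p by blast
qed

text \<open>
  The part of the closure of \<open>A n\<close> outside the union is closed with empty interior, so by Baire's
  theorem the complement of the union, which these parts fill, has empty interior.
\<close>
lemma dense_Union_interior_closure:
  fixes A :: "nat \<Rightarrow> 'a::complete_space set"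
  assumes "(\<Union>n. A n) = UNIV"
  shows "closure (\<Union>n. interior (closure (A n))) = UNIV"
proof -
  define U where "U = (\<Union>n. interior (closure (A n)))"
  define T where "T = (\<lambda>n. closure (A n) - U)"
  have "interior (T n) = {}" for n
  proof -
    have "interior (T n) \<subseteq> interior (closure (A n))"
      unfolding T_def by (intro interior_mono Diff_subset)
    then have "interior (T n) \<subseteq> U"
      unfolding U_def by blast
    moreover have "interior (T n) \<subseteq> - U"
      using interior_subset[of "T n"] unfolding T_def by blast
    ultimately show ?thesis
      by blast
  qed
  moreover have "closed (T n)" for n
    unfolding T_def U_def by (intro closed_Diff) auto
  ultimately have "euclidean interior_of \<Union>(range T) = {}"
    using completely_metrizable_space_euclidean
    by (intro Baire_category_alt disjI1) (simp_all add: image_iff flip: closed_closedin, blast+)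
  moreover have "\<Union>(range T) = - U"
  proof -
    have "x \<in> (\<Union>n. closure (A n))" for x
      using assms closure_subset by blast
    then show ?thesis
      unfolding T_def by blast
  qed
  ultimately have "interior (- U) = {}"
    by simp
  then show ?thesis
    unfolding U_def[symmetric] interior_complement by blast
qed

text \<open>
  The common constant \<open>c\<close> controls moving from \<open>x0\<close> to a nearby point with \<open>y\<close> kept fixed,
  and an interpolating \<open>f\<close> controls moving on to the value at \<open>x0\<close> and \<open>e\<close>. The point \<open>e\<close> may lie
  outside \<open>A\<close>, which is what lets continuity extend to the closure of \<open>A\<close>.
\<close>
lemma superposition_tendsto_within_uniformly_lipschitz:
  fixes Xi :: "'a::metric_space \<Rightarrow> 'e::real_normed_vector \<Rightarrow> 'f::real_normed_vector"
  assumes acts: "\<And>f. f \<in> Lip X \<Longrightarrow> (\<lambda>x. Xi x (f x)) \<in> Lip X"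
    and x0: "x0 \<in> X" "x0 islimpt X"
    and A: "\<And>y. y \<in> A \<Longrightarrow> c-lipschitz_on X (\<lambda>x. Xi x y)"
    and "0 < \<epsilon>"
  shows "\<exists>\<delta>>0. \<forall>y\<in>A. dist y e < \<delta> \<longrightarrow> dist (Xi x0 y) (Xi x0 e) < \<epsilon>"
proof (rule ccontr)
  assume "\<not> ?thesis"
  then have bad: "\<exists>y\<in>A. dist y e < \<delta> \<and> \<epsilon> \<le> dist (Xi x0 y) (Xi x0 e)" if "0 < \<delta>" for \<delta>
    using that by force
  obtain p where p: "\<And>k::nat. p k \<in> X" "\<And>k. 0 < dist (p k) x0"
      "\<And>k. 2 * dist (p (Suc k)) x0 \<le> dist (p k) x0" "(\<lambda>k. dist (p k) x0) \<longlonglongrightarrow> 0"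
    using lacunary_sequence_to_limit_point[OF x0(2)] by blast
  obtain y where y: "\<And>k. y k \<in> A" "\<And>k. dist (y k) e < dist (p k) x0"
      "\<And>k. \<epsilon> \<le> dist (Xi x0 (y k)) (Xi x0 e)"
    using bad[OF p(2)] by metis
  obtain f where f: "8-lipschitz_on UNIV f" "f x0 = e" "\<And>k. f (p k) = y k"
    using lipschitz_interpolation_lacunary[of p x0 y e, OF p(2,3) less_imp_le[OF y(2)]] by metis
  have "f \<in> Lip X"
    using f(1) lipschitz_on_subset unfolding Lip_def by blast
  then obtain C where C: "C-lipschitz_on X (\<lambda>x. Xi x (f x))"
    using acts unfolding Lip_def by blast
  have "\<epsilon> \<le> (c + C) * dist (p k) x0" for k
  proof -
    have "\<epsilon> \<le> dist (Xi x0 (y k)) (Xi x0 e)"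
      by (rule y)
    also have "\<dots> \<le> dist (Xi (p k) (y k)) (Xi x0 (y k)) + dist (Xi (p k) (y k)) (Xi x0 e)"
      by (rule dist_triangle3)
    also have "\<dots> \<le> c * dist (p k) x0 + C * dist (p k) x0"
      using lipschitz_onD[OF A[OF y(1)] p(1) x0(1), of k k] lipschitz_onD[OF C p(1) x0(1), of k] f
      by (intro add_mono) auto
    finally show ?thesis
      by (simp add: distrib_right)
  qed
  moreover have "(\<lambda>k. (c + C) * dist (p k) x0) \<longlonglongrightarrow> 0"
    using p(4) by (rule tendsto_mult_right_zero)
  ultimately have "\<epsilon> \<le> 0"
    by (intro LIMSEQ_le_const) auto
  with \<open>0 < \<epsilon>\<close> show False
    by simp
qed

theorem theorem8p10:
  fixes X :: "'a::metric_space set"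
    and Xi :: "'a \<Rightarrow> 'e::banach \<Rightarrow> 'f::banach"
    and x0 :: 'a
  assumes "bounded X"
    and "\<And>f :: 'a \<Rightarrow> 'e. f \<in> Lip X \<Longrightarrow> (\<lambda>x. Xi x (f x)) \<in> Lip X"
    and "x0 \<in> X"
    and "x0 islimpt X"
  shows "\<exists>U :: 'e set. open U \<and> closure U = UNIV \<and> continuous_on U (Xi x0)"
proof -
  define A where "A = (\<lambda>n::nat. {e. (real n)-lipschitz_on X (\<lambda>x. Xi x e)})"
  define U where "U = (\<Union>n. interior (closure (A n)))"
  have "\<exists>n. e \<in> A n" for e
  proof -
    have "(\<lambda>x. e) \<in> Lip X"
      unfolding Lip_def using lipschitz_on_constant by blast
    then obtain C where C: "C-lipschitz_on X (\<lambda>x. Xi x e)"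
      using assms(2) unfolding Lip_def by blast
    obtain n where "C \<le> real n"
      using real_arch_simple by blast
    with C show ?thesis
      unfolding A_def using lipschitz_on_mono by blast
  qed
  then have dense: "closure U = UNIV"
    unfolding U_def by (intro dense_Union_interior_closure) auto
  have "continuous_on (closure (A n)) (Xi x0)" for n
  proof -
    have "\<exists>\<delta>>0. \<forall>y\<in>A n. dist y e < \<delta> \<longrightarrow> dist (Xi x0 y) (Xi x0 e) < \<epsilon>" if "0 < \<epsilon>" for e \<epsilon>
      by (rule superposition_tendsto_within_uniformly_lipschitz[where X = X and c = "real n"])
        (use assms(2-4) that in \<open>simp_all add: A_def\<close>)
    then show ?thesis
      unfolding continuous_on_closure by blast
  qed
  then have "continuous_on (interior (closure (A n))) (Xi x0)" for n
    using continuous_on_subset interior_subset by blast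
  then have "continuous_on U (Xi x0)"
    unfolding U_def by (intro continuous_on_open_UN) auto
  moreover have "open U"
    unfolding U_def by blast
  ultimately show ?thesis
    using dense by blast
qed

end
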